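(* Let $G$ be a finite graph with positive Bakry-\'Emery curvature at every vertex, i.e. $G$ satisfies $CD(K,\infty)$ for some $K>0$, and let $\mathbb F$ be a field of characteristic $0$. Then the first path homology group of $G$ over $\mathbb F$ is trivial: $H_1(G,\mathbb F)=0$.
   Context: Graphs are simple and undirected, $G=(V,E)$; $x\sim y$ means $\{x,y\}\in E$. Curvature. For $f:V\to\mathbb R$ put $\Delta f(x)=\sum_{y\sim x}(f(y)-f(x))$, and for $f,g:V\to\mathbb R$ put $\Gamma(f,g)=\frac12(\Delta(fg)-f\Delta g-g\Delta f)$, $\Gamma_2(f,g)=\frac12(\Delta\Gamma(f,g)-\Gamma(f,\Delta g)-\Gamma(g,\Delta f))$, $\Gamma(f)=\Gamma(f,f)$, $\Gamma_2(f)=\Gamma_2(f,f)$. $G$ satisfies $CD(K,n)$ ($K\in\mathbb R$, $n\in(0,\infty]$) if $\Gamma_2(f)\ge\frac1n(\Delta f)^2+K\,\Gamma(f)$ holds at every vertex for all $f:V\to\mathbb R$; for $n=\infty$ the term $\frac1n(\Delta f)^2$ is $0$. Path homology. An undirected graph is regarded as a directed graph with arc set $\vec E$ containing both arcs $xy$ and $yx$ for every edge $\{x,y\}$. For $m\ge 0$ let $\Lambda_m$ be the $\mathbb F$-vector space with basis $\{e_{i_0\dots i_m}: i_0,\dots,i_m\in V\}$, let $\Lambda_{-1}=0$, and let $\partial:\Lambda_m\to\Lambda_{m-1}$ be linear with $\partial e_{i_0\dots i_m}=\sum_{k=0}^m(-1)^k e_{i_0\dots\hat{i_k}\dots i_m}$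 (hat denotes omission), with $\partial=0$ on $\Lambda_0$. Let $I_m\subset\Lambda_m$ be the span of those $e_{i_0\dots i_m}$ with $i_k=i_{k+1}$ for some $k$, and $\mathcal R_m=\Lambda_m/I_m$, with the induced boundary map $\partial$ (irregular paths are treated as $0$). Let $\mathcal A_m\subset\mathcal R_m$ be the span of those $e_{i_0\dots i_m}$ with $i_ki_{k+1}\in\vec E$ for all $k$ (allowed paths), and $\Omega_m=\{p\in\mathcal A_m:\partial p\in\mathcal A_{m-1}\}$. Then $\partial\Omega_m\subseteq\Omega_{m-1}$, $\partial^2=0$, and $H_n(G,\mathbb F)=\ker(\partial|_{\Omega_n})/\operatorname{im}(\partial|_{\Omega_{n+1}})$. *)

theory Defs
  imports
    "HOL-Library.Extended_Real"
    "HOL-Library.Poly_Mapping"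
    "HOL-Algebra.Elementary_Groups"
    "Graph_Theory.Pair_Digraph"
begin

text \<open>
  A finite simple undirected graph is a \<open>pair_graph\<close>, i.e. a finite, loop-free, symmetric digraph
  whose arcs are ordered pairs of vertices. Each edge thus contributes both of its orientations to
  \<^const>\<open>parcs\<close>, so that \<^const>\<open>parcs\<close> is at once the adjacency relation and the arc set of the
  associated directed graph.
\<close>

section \<open>Bakry-Emery curvature\<close>

text \<open>
  Functions on the vertex set are represented by functions on the whole vertex type; at a vertex,
  all operators below only depend on the values on \<^term>\<open>pverts G\<close>.
\<close>

definition laplacian :: "'a pair_pre_digraph \<Rightarrow> ('a \<Rightarrow> real) \<Rightarrow> 'a \<Rightarrow> real" where
  "laplacian G f x = (\<Sum>y | (x, y) \<in> parcs G. f y - f x)"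

definition Gamma :: "'a pair_pre_digraph \<Rightarrow> ('a \<Rightarrow> real) \<Rightarrow> ('a \<Rightarrow> real) \<Rightarrow> 'a \<Rightarrow> real" where
  "Gamma G f g x =
     (laplacian G (\<lambda>y. f y * g y) x - f x * laplacian G g x - g x * laplacian G f x) / 2"

definition Gamma2 :: "'a pair_pre_digraph \<Rightarrow> ('a \<Rightarrow> real) \<Rightarrow> ('a \<Rightarrow> real) \<Rightarrow> 'a \<Rightarrow> real" where
  "Gamma2 G f g x =
     (laplacian G (Gamma G f g) x - Gamma G f (laplacian G g) x - Gamma G g (laplacian G f) x) / 2"

text \<open>For \<open>n = \<infinity>\<close> the coefficient of the first term is \<open>1 / \<infinity> = 0\<close> in \<^typ>\<open>ereal\<close>.\<close>

definition curvature_dimension :: "'a pair_pre_digraph \<Rightarrow> real \<Rightarrow> ereal \<Rightarrow> bool" where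
  "curvature_dimension G K n \<longleftrightarrow> 0 < n \<and>
     (\<forall>f. \<forall>x\<in>pverts G.
        Gamma2 G f f x \<ge> real_of_ereal (1 / n) * (laplacian G f x)\<^sup>2 + K * Gamma G f f x)"

section \<open>Path homology\<close>

text \<open>
  A path \<open>i\<^sub>0 \<dots> i\<^sub>m\<close> is a list of length \<open>m + 1\<close>, and formal linear combinations of paths are
  finitely supported functions on lists. Degrees are integers, so that degree \<open>-1\<close> can be treated
  uniformly; the empty list is not a path, hence all spaces of negative degree are \<open>0\<close>.
\<close>

definition path_scale :: "'f::field \<Rightarrow> ('a list \<Rightarrow>\<^sub>0 'f) \<Rightarrow> ('a list \<Rightarrow>\<^sub>0 'f)" where
  "path_scale c p = Poly_Mapping.map (\<lambda>x. c * x) p"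

lemma lookup_path_scale [simp]: "Poly_Mapping.lookup (path_scale c p) i = c * Poly_Mapping.lookup p i"
  by (simp add: path_scale_def map.rep_eq when_def)

interpretation path_chain: vector_space path_scale
  by unfold_locales (auto intro!: poly_mapping_eqI simp: lookup_add algebra_simps)

abbreviation elem_path :: "'a list \<Rightarrow> ('a list \<Rightarrow>\<^sub>0 'f::field)" where
  "elem_path i \<equiv> Poly_Mapping.single i 1"

definition paths :: "'a pair_pre_digraph \<Rightarrow> int \<Rightarrow> 'a list set" where
  "paths G m = {i. i \<noteq> [] \<and> int (length i) = m + 1 \<and> set i \<subseteq> pverts G}"

definition irregular_paths :: "'a pair_pre_digraph \<Rightarrow> int \<Rightarrow> 'a list set" where
  "irregular_paths G m = {i \<in> paths G m. \<exists>k. Suc k < length i \<and> i ! k = i ! Suc k}"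

definition allowed_paths :: "'a pair_pre_digraph \<Rightarrow> int \<Rightarrow> 'a list set" where
  "allowed_paths G m = {i \<in> paths G m. \<forall>k. Suc k < length i \<longrightarrow> (i ! k, i ! Suc k) \<in> parcs G}"

definition path_space :: "'a pair_pre_digraph \<Rightarrow> int \<Rightarrow> ('a list \<Rightarrow>\<^sub>0 'f::field) set"
  where "path_space G m = path_chain.span (elem_path ` paths G m)"

definition irregular_space :: "'a pair_pre_digraph \<Rightarrow> int \<Rightarrow> ('a list \<Rightarrow>\<^sub>0 'f::field) set"
  where "irregular_space G m = path_chain.span (elem_path ` irregular_paths G m)"

definition elem_boundary :: "'a list \<Rightarrow> ('a list \<Rightarrow>\<^sub>0 'f::field)" where
  "elem_boundary i =
     (if length i \<le> 1 then 0
      else \<Sum>k<length i. path_scale ((- 1) ^ k) (elem_path (take k i @ drop (Suc k) i)))"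

definition path_boundary :: "('a list \<Rightarrow>\<^sub>0 'f::field) \<Rightarrow> ('a list \<Rightarrow>\<^sub>0 'f)" where
  "path_boundary p =
     (\<Sum>i\<in>Poly_Mapping.keys p. path_scale (Poly_Mapping.lookup p i) (elem_boundary i))"

text \<open>
  Quotients of vector spaces are formed as quotients of their (multiplicatively written) additive
  groups; an element of such a quotient is a coset.
\<close>

definition path_group :: "'a pair_pre_digraph \<Rightarrow> int \<Rightarrow> ('a list \<Rightarrow>\<^sub>0 'f::field) monoid" where
  "path_group G m = \<lparr>carrier = path_space G m, monoid.mult = (+), one = 0\<rparr>"

definition regular_group :: "'a pair_pre_digraph \<Rightarrow> int \<Rightarrow> ('a list \<Rightarrow>\<^sub>0 'f::field) set monoid" where
  "regular_group G m = path_group G m Mod irregular_space G m"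

definition regular_class ::
    "'a pair_pre_digraph \<Rightarrow> int \<Rightarrow> ('a list \<Rightarrow>\<^sub>0 'f::field) \<Rightarrow> ('a list \<Rightarrow>\<^sub>0 'f) set" where
  "regular_class G m p = irregular_space G m #>\<^bsub>path_group G m\<^esub> p"

text \<open>
  The map induced by \<^const>\<open>path_boundary\<close> from degree \<open>m\<close> to degree \<open>m - 1\<close> of the quotients. It
  is independent of representatives, see \<open>regular_boundary_class\<close> below.
\<close>

definition regular_boundary ::
    "'a pair_pre_digraph \<Rightarrow> int \<Rightarrow> ('a list \<Rightarrow>\<^sub>0 'f::field) set \<Rightarrow> ('a list \<Rightarrow>\<^sub>0 'f) set" where
  "regular_boundary G m C = the_elem ((\<lambda>p. regular_class G (m - 1) (path_boundary p)) ` C)"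

text \<open>The span of the classes of the allowed paths, i.e. the image of the span of these paths.\<close>

definition allowed_space :: "'a pair_pre_digraph \<Rightarrow> int \<Rightarrow> ('a list \<Rightarrow>\<^sub>0 'f::field) set set" where
  "allowed_space G m = regular_class G m ` path_chain.span (elem_path ` allowed_paths G m)"

definition Omega :: "'a pair_pre_digraph \<Rightarrow> int \<Rightarrow> ('a list \<Rightarrow>\<^sub>0 'f::field) set set" where
  "Omega G m = {C \<in> allowed_space G m. regular_boundary G m C \<in> allowed_space G (m - 1)}"

definition Omega_group :: "'a pair_pre_digraph \<Rightarrow> int \<Rightarrow> ('a list \<Rightarrow>\<^sub>0 'f::field) set monoid" where
  "Omega_group G m = (regular_group G m)\<lparr>carrier := Omega G m\<rparr>"

definition path_homology ::
    "'f::field itself \<Rightarrow> 'a pair_pre_digraph \<Rightarrow> int \<Rightarrow> ('a list \<Rightarrow>\<^sub>0 'f) set set monoid" where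
  "path_homology _ G n =
     (Omega_group G n)\<lparr>carrier :=
        kernel (Omega_group G n) (Omega_group G (n - 1)) (regular_boundary G n)\<rparr>
     Mod (regular_boundary G (n + 1) ` Omega G (n + 1))"

subsection \<open>The induced boundary map is well defined\<close>

lemma path_boundary_superset:
  assumes "finite S" "Poly_Mapping.keys p \<subseteq> S"
  shows "path_boundary p = (\<Sum>i\<in>S. path_scale (Poly_Mapping.lookup p i) (elem_boundary i))"
  unfolding path_boundary_def using assms
  by (intro sum.mono_neutral_left) (auto simp: in_keys_iff)

lemma path_boundary_add: "path_boundary (p + q) = path_boundary p + path_boundary q"
proof -
  let ?S = "Poly_Mapping.keys p \<union> Poly_Mapping.keys q"
  have "path_boundary r = (\<Sum>i\<in>?S. path_scale (Poly_Mapping.lookup r i) (elem_boundary i))"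
    if "r \<in> {p, q, p + q}" for r
    using that Poly_Mapping.keys_add[of p q] by (intro path_boundary_superset) auto
  then show ?thesis
    by (simp add: lookup_add path_chain.scale_left_distrib sum.distrib)
qed

lemma path_boundary_scale: "path_boundary (path_scale c p) = path_scale c (path_boundary p)"
proof -
  have "path_boundary (path_scale c p) = (\<Sum>i\<in>Poly_Mapping.keys p.
      path_scale (Poly_Mapping.lookup (path_scale c p) i) (elem_boundary i))"
    by (intro path_boundary_superset) (auto simp: in_keys_iff)
  then show ?thesis
    by (simp add: path_boundary_def path_chain.scale_sum_right)
qed

lemma path_boundary_elem [simp]: "path_boundary (elem_path i) = elem_boundary i"
  by (simp add: path_boundary_def)

lemma path_boundary_zero [simp]: "path_boundary 0 = 0"
  by (simp add: path_boundary_def)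

lemma elem_boundary_irregular:
  assumes i: "i \<in> irregular_paths G m"
  shows "elem_boundary i \<in> irregular_space G (m - 1)"
proof -
  obtain a where a: "Suc a < length i" "i ! a = i ! Suc a" and iP: "i \<in> paths G m"
    using i by (auto simp: irregular_paths_def)
  define d where "d k = take k i @ drop (Suc k) i" for k
  define t :: "nat \<Rightarrow> 'a list \<Rightarrow>\<^sub>0 'b" where "t k = path_scale ((- 1) ^ k) (elem_path (d k))" for k
  have nth_d: "d k ! j = (if j < k then i ! j else i ! Suc j)"
    if "k < length i" "Suc j < length i" for k j
    using that by (auto simp: d_def nth_append min_def)
  have len_d: "length (d k) = length i - 1" if "k < length i" for k
    using that by (auto simp: d_def)
  have irr: "d k \<in> irregular_paths G (m - 1)" if k: "k < length i" "k \<noteq> a" "k \<noteq> Suc a" for k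
  proof -
    have "length i > 2"
      using k a by auto
    moreover have "set (d k) \<subseteq> set i"
      by (auto simp: d_def dest: in_set_takeD in_set_dropD)
    ultimately have "d k \<in> paths G (m - 1)"
      using iP k len_d[of k] by (auto simp: paths_def)
    moreover have "\<exists>j. Suc j < length (d k) \<and> d k ! j = d k ! Suc j"
    proof (cases "k < a")
      case True
      then show ?thesis
        using a k by (intro exI[of _ "a - 1"]) (auto simp: len_d nth_d)
    next
      case False
      then show ?thesis
        using a k by (intro exI[of _ a]) (auto simp: len_d nth_d)
    qed
    ultimately show ?thesis
      by (simp add: irregular_paths_def)
  qed
  have "d a = d (Suc a)"
    using a by (intro nth_equalityI) (auto simp: len_d nth_d less_Suc_eq)
  then have cancel: "t a + t (Suc a) = 0"
    by (simp add: t_def)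
  have "elem_boundary i = (\<Sum>k<length i. t k)"
    using a by (simp add: elem_boundary_def t_def d_def)
  also have "\<dots> = (\<Sum>k\<in>{..<length i} - {a, Suc a}. t k) + (\<Sum>k\<in>{a, Suc a}. t k)"
    using a by (intro sum.subset_diff) auto
  also have "\<dots> = (\<Sum>k\<in>{..<length i} - {a, Suc a}. t k)"
    using cancel by simp
  also have "\<dots> \<in> irregular_space G (m - 1)"
    unfolding irregular_space_def t_def
    by (intro path_chain.span_sum path_chain.span_scale path_chain.span_base) (auto intro: irr)
  finally show ?thesis .
qed

lemma path_boundary_irregular:
  assumes "p \<in> irregular_space G m"
  shows "path_boundary p \<in> irregular_space G (m - 1)"
  using assms unfolding irregular_space_def[of G m]
proof (induction rule: path_chain.span_induct_alt)
  case base
  then show ?case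
    by (simp add: irregular_space_def path_chain.span_zero)
next
  case (step c x y)
  then show ?case
    using elem_boundary_irregular[of _ G m]
    by (auto simp: path_boundary_add path_boundary_scale irregular_space_def
        intro!: path_chain.span_add path_chain.span_scale)
qed

lemma regular_class_eq: "regular_class G m p = (\<lambda>q. q + p) ` irregular_space G m"
  by (auto simp: regular_class_def r_coset_def path_group_def)

lemma regular_class_absorb:
  assumes "q \<in> irregular_space G m"
  shows "regular_class G m (q + p) = regular_class G m p"
proof -
  have "r + (q + p) \<in> (\<lambda>q. q + p) ` irregular_space G m"
    if "r \<in> irregular_space G m" for r
    using that assms
    by (intro image_eqI[of _ _ "r + q"])
      (auto simp: irregular_space_def add.assoc intro: path_chain.span_add)
  moreover have "r + p \<in> (\<lambda>r. r + (q + p)) ` irregular_space G m"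
    if "r \<in> irregular_space G m" for r
    using that assms
    by (intro image_eqI[of _ _ "r - q"])
      (auto simp: irregular_space_def algebra_simps intro: path_chain.span_diff)
  ultimately show ?thesis
    by (auto simp: regular_class_eq)
qed

lemma regular_boundary_class:
  "regular_boundary G m (regular_class G m p) = regular_class G (m - 1) (path_boundary p)"
proof -
  have "(0 :: 'a list \<Rightarrow>\<^sub>0 'b) \<in> irregular_space G m"
    by (simp add: irregular_space_def path_chain.span_zero)
  then have "(\<lambda>p. regular_class G (m - 1) (path_boundary p)) ` regular_class G m p
      = {regular_class G (m - 1) (path_boundary p)}"
    by (auto simp: regular_class_eq[of G m] path_boundary_add path_boundary_irregular
        regular_class_absorb image_iff intro!: bexI[of _ 0])
  then show ?thesis
    by (simp add: regular_boundary_def)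
qed

end

theory Submission
  imports Defs
begin

text \<open>
  The proof is a discrete version of Bochner's argument. Call a function \<open>\<phi>\<close> on arcs closed if it is
  antisymmetric and additive around triangles and squares, and coclosed if its values on the arcs
  leaving any vertex sum to \<open>0\<close>. Closedness is exactly what is needed to find, for a vertex \<open>x\<close>,
  a function \<open>f\<close> whose differential is \<open>\<phi>\<close> on all arcs at \<open>x\<close> and at the neighbours of \<open>x\<close>, and
  \<open>\<Gamma>\<^sub>2(f)(x)\<close> depends on the differential of \<open>f\<close> along these arcs only. If \<open>\<phi>\<close> is also coclosed, then \<open>f\<close> is
  harmonic around \<open>x\<close>, so that \<open>\<Gamma>\<^sub>2(f)(x) = \<Delta>E(x) / 2\<close>, where the energy density
  \<open>E(y) = (\<Sum>z. \<phi>(y, z)\<^sup>2) / 2\<close> no longer refers to \<open>x\<close> or \<open>f\<close>. The curvature condition therefore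
  says \<open>\<Delta>E \<ge> 2 K E\<close> at every vertex, whereas \<open>\<Delta>E\<close> sums to \<open>0\<close> over the graph. Hence \<open>E = 0\<close>,
  and \<open>\<phi> = 0\<close>: this is \<open>harmonic_form_eq_0\<close>.

  The link with homology is that antisymmetry, triangles and squares correspond to the boundaries
  of the elements \<open>e\<^bsub>aba\<^esub>\<close>, \<open>e\<^bsub>abc\<^esub>\<close> (with \<open>a \<sim> c\<close>) and \<open>e\<^bsub>abc\<^esub> - e\<^bsub>adc\<^esub>\<close> of \<open>\<Omega>\<^sub>2\<close>. Let \<open>R\<close> be
  the span of these boundaries. Over the rationals, every cycle is the sum of an element of \<open>R\<close> and
  of a chain orthogonal to \<open>R\<close>. The latter is a cycle as well; read as a function on arcs it is
  closed by orthogonality and coclosed because it is an antisymmetric cycle, hence it is \<open>0\<close>. So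
  all rational cycles lie in \<open>R\<close> (\<open>rational_cycle_in_span_relations\<close>). Over a field of
  characteristic \<open>0\<close>, the coordinates of a cycle with respect to a basis of the field over the
  rationals are rational cycles, which gives the same conclusion (\<open>cycle_in_span_relations\<close>).
\<close>

section \<open>The Bochner argument\<close>

lemma Gamma_eq_sum:
  assumes "finite (parcs G)"
  shows "Gamma G f g x = (\<Sum>y | (x, y) \<in> parcs G. (f y - f x) * (g y - g x)) / 2"
  by (simp add: Gamma_def laplacian_def sum_distrib_left algebra_simps
      flip: sum.distrib sum_subtractf)

context pair_graph
begin

lemma finite_neighbours [simp]: "finite {y. (x, y) \<in> parcs G}"
  by (rule finite_subset[OF _ finite_imageI[OF pair_finite_arcs, of snd]]) force

lemma sum_neighbours_swap:
  fixes f :: "'a \<Rightarrow> 'a \<Rightarrow> 'b::comm_monoid_add"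
  shows "(\<Sum>x\<in>pverts G. \<Sum>y | (x, y) \<in> parcs G. f x y)
       = (\<Sum>x\<in>pverts G. \<Sum>y | (x, y) \<in> parcs G. f y x)"
proof -
  have "(\<Sum>x\<in>pverts G. \<Sum>y | (x, y) \<in> parcs G. f x y)
      = (\<Sum>x\<in>pverts G. \<Sum>y | y \<in> pverts G \<and> (x, y) \<in> parcs G. f x y)" for f :: "'a \<Rightarrow> 'a \<Rightarrow> 'b"
    by (intro sum.cong refl) (auto dest: arc_snd_in_verts)
  moreover have "(x, y) \<in> parcs G \<longleftrightarrow> (y, x) \<in> parcs G" for x y
    using arcs_symmetric by blast
  ultimately show ?thesis
    using sum.swap_restrict[OF pair_finite_verts pair_finite_verts,
        of f "\<lambda>x y. (x, y) \<in> parcs G"]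
    by simp
qed

lemma sum_laplacian_eq_0: "(\<Sum>x\<in>pverts G. laplacian G f x) = 0"
  using sum_neighbours_swap[of "\<lambda>x y. f y"]
  by (simp add: laplacian_def sum_subtractf)

text \<open>
  The potential is obtained by integrating along paths of length at most two that start in \<open>x\<close>. A
  vertex at distance one may also be reached by a path of length two, and a vertex at distance two
  by several of these: triangles and squares, respectively, make the result independent of the path.
  For paths that return to \<open>x\<close> this is antisymmetry.
\<close>

lemma local_potential:
  fixes \<phi> :: "'a \<Rightarrow> 'a \<Rightarrow> 'b::ab_group_add"
  assumes anti: "\<And>a b. (a, b) \<in> parcs G \<Longrightarrow> \<phi> b a = - \<phi> a b"
    and triangle: "\<And>a b c. (a, b) \<in> parcs G \<Longrightarrow> (b, c) \<in> parcs G \<Longrightarrow> (a, c) \<in> parcs G \<Longrightarrow>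
      \<phi> a c = \<phi> a b + \<phi> b c"
    and square: "\<And>a b c d. (a, b) \<in> parcs G \<Longrightarrow> (b, c) \<in> parcs G \<Longrightarrow>
      (a, d) \<in> parcs G \<Longrightarrow> (d, c) \<in> parcs G \<Longrightarrow> \<phi> a b + \<phi> b c = \<phi> a d + \<phi> d c"
  shows "\<exists>f. \<forall>y z. (y = x \<or> (x, y) \<in> parcs G) \<and> (y, z) \<in> parcs G \<longrightarrow> f z - f y = \<phi> y z"
proof -
  define f where "f z = (if z = x then 0 else if (x, z) \<in> parcs G then \<phi> x z
    else let y = SOME y. (x, y) \<in> parcs G \<and> (y, z) \<in> parcs G in \<phi> x y + \<phi> y z)" for z
  have f_nbr: "f y = \<phi> x y" if "(x, y) \<in> parcs G" for y
    using that pair_no_loops[OF that] by (auto simp: f_def)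
  have f_two: "f z = \<phi> x y + \<phi> y z" if y: "(x, y) \<in> parcs G" "(y, z) \<in> parcs G" for y z
  proof -
    consider "z = x" | "(x, z) \<in> parcs G" | "z \<noteq> x" "(x, z) \<notin> parcs G"
      by blast
    then show ?thesis
    proof cases
      case 1
      then show ?thesis
        using anti[OF y(1)] by (simp add: f_def)
    next
      case 2
      then show ?thesis
        using triangle[OF y 2] f_nbr by simp
    next
      case 3
      define w where "w = (SOME y. (x, y) \<in> parcs G \<and> (y, z) \<in> parcs G)"
      have "(x, w) \<in> parcs G \<and> (w, z) \<in> parcs G"
        unfolding w_def by (rule someI[of _ y]) (use y in simp)
      then show ?thesis
        using 3 square[OF y, of w] by (simp add: f_def flip: w_def)
    qed
  qed
  have "f x = 0"
    by (simp add: f_def)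
  then have "f z - f y = \<phi> y z" if "y = x \<or> (x, y) \<in> parcs G" "(y, z) \<in> parcs G" for y z
    using that f_nbr f_two by auto
  then show ?thesis
    by blast
qed

text \<open>
  The vanishing theorem for harmonic \<open>1\<close>-forms. A form that is not exact has no global potential, so
  the curvature condition is applied at each vertex \<open>x\<close> to a potential that depends on \<open>x\<close>. The
  resulting inequalities can still be summed, since they only involve the energy density \<open>E\<close>, which
  is defined by the form itself.
\<close>

lemma harmonic_form_eq_0:
  fixes \<phi> :: "'a \<Rightarrow> 'a \<Rightarrow> real"
  assumes K: "K > 0" "curvature_dimension G K \<infinity>"
    and anti: "\<And>a b. (a, b) \<in> parcs G \<Longrightarrow> \<phi> b a = - \<phi> a b"
    and triangle: "\<And>a b c. (a, b) \<in> parcs G \<Longrightarrow> (b, c) \<in> parcs G \<Longrightarrow> (a, c) \<in> parcs G \<Longrightarrow>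
      \<phi> a c = \<phi> a b + \<phi> b c"
    and square: "\<And>a b c d. (a, b) \<in> parcs G \<Longrightarrow> (b, c) \<in> parcs G \<Longrightarrow>
      (a, d) \<in> parcs G \<Longrightarrow> (d, c) \<in> parcs G \<Longrightarrow> \<phi> a b + \<phi> b c = \<phi> a d + \<phi> d c"
    and coclosed: "\<And>a. a \<in> pverts G \<Longrightarrow> (\<Sum>b | (a, b) \<in> parcs G. \<phi> a b) = 0"
    and ab: "(a, b) \<in> parcs G"
  shows "\<phi> a b = 0"
proof -
  define E where "E x = (\<Sum>y | (x, y) \<in> parcs G. (\<phi> x y)\<^sup>2) / 2" for x
  have E_nonneg: "E x \<ge> 0" for x
    by (simp add: E_def sum_nonneg)
  have bochner: "laplacian G E x / 2 \<ge> K * E x" if x: "x \<in> pverts G" for x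
  proof -
    obtain f where
      f: "\<And>y z. y = x \<or> (x, y) \<in> parcs G \<Longrightarrow> (y, z) \<in> parcs G \<Longrightarrow> f z - f y = \<phi> y z"
      using local_potential[of \<phi> x, OF anti triangle square] by blast
    have harmonic: "laplacian G f y = 0" if "y = x \<or> (x, y) \<in> parcs G" for y
    proof -
      have "laplacian G f y = (\<Sum>z | (y, z) \<in> parcs G. \<phi> y z)"
        unfolding laplacian_def using f that by (intro sum.cong) auto
      then show ?thesis
        using coclosed[of y] that x by (auto dest: arc_snd_in_verts)
    qed
    have Gamma_f: "Gamma G f f y = E y" if "y = x \<or> (x, y) \<in> parcs G" for y
      unfolding Gamma_eq_sum[OF pair_finite_arcs] E_def using f that
      by (intro arg_cong2[where f = "(/)"] sum.cong) (auto simp: power2_eq_square)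
    \<comment> \<open>\<open>Gamma\<close> only compares \<open>x\<close> with its neighbours, and \<open>laplacian G f\<close> vanishes at all of these.\<close>
    have "laplacian G (Gamma G f f) x = laplacian G E x"
      unfolding laplacian_def by (intro sum.cong) (auto simp: Gamma_f)
    moreover have "Gamma G f (laplacian G f) x = 0"
      unfolding Gamma_eq_sum[OF pair_finite_arcs] by (auto simp: harmonic intro!: sum.neutral)
    ultimately have "Gamma2 G f f x = laplacian G E x / 2"
      by (simp add: Gamma2_def)
    moreover have "Gamma2 G f f x \<ge> K * Gamma G f f x"
      using K(2) x by (simp add: curvature_dimension_def)
    ultimately show ?thesis
      by (simp add: Gamma_f)
  qed
  have "K * (\<Sum>x\<in>pverts G. E x) \<le> (\<Sum>x\<in>pverts G. laplacian G E x) / 2"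
    unfolding sum_distrib_left sum_divide_distrib by (intro sum_mono bochner)
  also have "\<dots> = 0"
    by (simp add: sum_laplacian_eq_0)
  finally have "(\<Sum>x\<in>pverts G. E x) \<le> 0"
    using K(1) by (simp add: mult_le_0_iff)
  then have "(\<Sum>x\<in>pverts G. E x) = 0"
    by (simp add: E_nonneg sum_nonneg antisym)
  then have "E a = 0"
    using arc_fst_in_verts[OF ab] by (simp add: sum_nonneg_eq_0_iff E_nonneg pair_finite_verts)
  then show ?thesis
    using ab by (simp add: E_def sum_nonneg_eq_0_iff)
qed

end

section \<open>Orthogonal decomposition of chains\<close>

abbreviation "lookup \<equiv> Poly_Mapping.lookup"
abbreviation "keys \<equiv> Poly_Mapping.keys"

definition dot :: "'i list set \<Rightarrow> ('i list \<Rightarrow>\<^sub>0 'k::linordered_field) \<Rightarrow> ('i list \<Rightarrow>\<^sub>0 'k) \<Rightarrow> 'k"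
  where "dot A p q = (\<Sum>i\<in>A. lookup p i * lookup q i)"

lemma dot_add_right: "dot A p (q + r) = dot A p q + dot A p r"
  and dot_diff_right: "dot A p (q - r) = dot A p q - dot A p r"
  and dot_diff_left: "dot A (p - q) r = dot A p r - dot A q r"
  and dot_add_left: "dot A (p + q) r = dot A p r + dot A q r"
  and dot_scale_left: "dot A (path_scale c p) q = c * dot A p q"
  and dot_scale_right: "dot A p (path_scale c q) = c * dot A p q"
  and dot_zero_right: "dot A p 0 = 0"
  by (simp_all add: dot_def lookup_add lookup_minus algebra_simps sum.distrib sum_subtractf
      sum_distrib_left)

lemma dot_elem_path: "finite A \<Longrightarrow> i \<in> A \<Longrightarrow> dot A p (elem_path i) = lookup p i"
  by (simp add: dot_def lookup_single when_def if_distrib cong: if_cong)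

lemma dot_self_eq_0:
  assumes "finite A" "dot A p p = 0" "i \<in> A"
  shows "lookup p i = 0"
  using assms by (simp add: dot_def sum_nonneg_eq_0_iff)

lemma dot_span_eq_0:
  assumes "q \<in> path_chain.span R" "\<And>r. r \<in> R \<Longrightarrow> dot A p r = 0"
  shows "dot A p q = 0"
  using assms(1)
  by (induction rule: path_chain.span_induct_alt)
    (simp_all add: assms(2) dot_zero_right dot_add_right dot_scale_right)

text \<open>
  This is Gram-Schmidt: a new generator \<open>r\<close> is first replaced by its component \<open>s\<close> orthogonal to the
  old ones, and \<open>z\<close> is then projected onto \<open>s\<close> as well. No square roots are taken, so the argument
  works over the rationals.
\<close>

lemma orthogonal_decomposition:
  fixes z :: "'i list \<Rightarrow>\<^sub>0 'k::linordered_field"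
  assumes R: "finite R" and A: "finite A"
  obtains p where "p \<in> path_chain.span R" "\<And>r. r \<in> R \<Longrightarrow> dot A (z - p) r = 0"
proof -
  have "\<exists>p\<in>path_chain.span R. \<forall>r\<in>R. dot A (z - p) r = 0"
    using R
  proof (induction R arbitrary: z)
    case empty
    show ?case
      using path_chain.span_zero by blast
  next
    case (insert r R)
    obtain p where p: "p \<in> path_chain.span R" "\<And>r'. r' \<in> R \<Longrightarrow> dot A (z - p) r' = 0"
      using insert.IH[of z] by blast
    obtain q where q: "q \<in> path_chain.span R" "\<And>r'. r' \<in> R \<Longrightarrow> dot A (r - q) r' = 0"
      using insert.IH[of r] by blast
    define s where "s = r - q"
    define t where "t = dot A (z - p) s / dot A s s"
    define p' where "p' = p + path_scale t s"
    have span_R: "path_chain.span R \<subseteq> path_chain.span (insert r R)"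
      by (intro path_chain.span_mono) auto
    then have "p' \<in> path_chain.span (insert r R)"
      unfolding p'_def s_def using p q
      by (intro path_chain.span_add path_chain.span_scale path_chain.span_diff)
        (auto intro: path_chain.span_base)
    moreover have z_p': "dot A (z - p') x = dot A (z - p) x - t * dot A s x" for x
      by (simp add: p'_def dot_diff_left dot_add_left dot_scale_left)
    have R_orth: "dot A (z - p') r' = 0" if "r' \<in> R" for r'
      using p(2) q(2) that by (simp add: z_p' s_def)
    moreover have "dot A (z - p') r = 0"
    proof -
      \<comment> \<open>If \<open>dot A s s = 0\<close>, then \<open>t = 0\<close> by the convention for division by \<open>0\<close>, so \<open>z - p\<close> has to be
        orthogonal to \<open>s\<close> already.\<close>
      have "dot A (z - p) s = 0" if "dot A s s = 0"
        using dot_self_eq_0[OF A that] by (simp add: dot_def)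
      then have "dot A (z - p') s = 0"
        by (auto simp: z_p' t_def)
      moreover have "dot A (z - p') q = 0"
        using q(1) R_orth by (rule dot_span_eq_0)
      ultimately show ?thesis
        by (simp add: s_def dot_diff_right)
    qed
    ultimately show ?case
      by blast
  qed
  with that show ?thesis
    by blast
qed

section \<open>Cycles are generated by short cycles\<close>

lemma keys_subset_iff_span: "keys p \<subseteq> S \<longleftrightarrow> p \<in> path_chain.span (elem_path ` S)"
proof
  assume S: "keys p \<subseteq> S"
  have "p = (\<Sum>i\<in>keys p. path_scale (lookup p i) (elem_path i))"
    by (rule poly_mapping_eqI)
      (simp add: lookup_sum lookup_single when_def in_keys_iff if_distrib cong: if_cong)
  moreover have "\<dots> \<in> path_chain.span (elem_path ` S)"
    using S by (intro path_chain.span_sum path_chain.span_scale path_chain.span_base) auto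
  ultimately show "p \<in> path_chain.span (elem_path ` S)"
    by simp
next
  assume "p \<in> path_chain.span (elem_path ` S)"
  then show "keys p \<subseteq> S"
  proof (induction rule: path_chain.span_induct_alt)
    case base
    then show ?case
      by simp
  next
    case (step c x y)
    then show ?case
      by (auto simp: in_keys_iff lookup_add lookup_single when_def subset_iff split: if_splits)
  qed
qed

lemma lookup_map_fun: "f 0 = 0 \<Longrightarrow> lookup (Poly_Mapping.map f p) i = f (lookup p i)"
  by (simp add: map.rep_eq when_def)

text \<open>
  The boundaries of \<open>e\<^bsub>aba\<^esub>\<close>, of \<open>e\<^bsub>abc\<^esub>\<close> for a triangle, and of \<open>e\<^bsub>abc\<^esub> - e\<^bsub>adc\<^esub>\<close> for a square. In
  the first and third case the boundary of \<open>e\<^bsub>abc\<^esub>\<close> alone contains \<open>e\<^bsub>ac\<^esub>\<close>, which need not be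
  allowed: it is irregular for \<open>a = c\<close>, and it cancels in the difference.
\<close>

definition relations :: "'a pair_pre_digraph \<Rightarrow> ('a list \<Rightarrow>\<^sub>0 'f::field) set" where
  "relations G =
     {elem_path [a, b] + elem_path [b, a] | a b. (a, b) \<in> parcs G} \<union>
     {elem_path [a, b] + elem_path [b, c] - elem_path [a, c] | a b c.
        (a, b) \<in> parcs G \<and> (b, c) \<in> parcs G \<and> (a, c) \<in> parcs G} \<union>
     {elem_path [a, b] + elem_path [b, c] - (elem_path [a, d] + elem_path [d, c]) | a b c d.
        (a, b) \<in> parcs G \<and> (b, c) \<in> parcs G \<and> (a, d) \<in> parcs G \<and> (d, c) \<in> parcs G}"

lemma relations_intros:
  "(a, b) \<in> parcs G \<Longrightarrow> elem_path [a, b] + elem_path [b, a] \<in> relations G"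
  "(a, b) \<in> parcs G \<Longrightarrow> (b, c) \<in> parcs G \<Longrightarrow> (a, c) \<in> parcs G \<Longrightarrow>
    elem_path [a, b] + elem_path [b, c] - elem_path [a, c] \<in> relations G"
  "(a, b) \<in> parcs G \<Longrightarrow> (b, c) \<in> parcs G \<Longrightarrow> (a, d) \<in> parcs G \<Longrightarrow> (d, c) \<in> parcs G \<Longrightarrow>
    elem_path [a, b] + elem_path [b, c] - (elem_path [a, d] + elem_path [d, c]) \<in> relations G"
  unfolding relations_def by blast+

lemma relations_cases:
  assumes "r \<in> relations G"
  obtains a b where "r = elem_path [a, b] + elem_path [b, a]" "(a, b) \<in> parcs G"
  | a b c where "r = elem_path [a, b] + elem_path [b, c] - elem_path [a, c]"
      "(a, b) \<in> parcs G" "(b, c) \<in> parcs G" "(a, c) \<in> parcs G"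
  | a b c d where "r = elem_path [a, b] + elem_path [b, c] - (elem_path [a, d] + elem_path [d, c])"
      "(a, b) \<in> parcs G" "(b, c) \<in> parcs G" "(a, d) \<in> parcs G" "(d, c) \<in> parcs G"
  using assms unfolding relations_def by blast

text \<open>Relations have integer coefficients, so extending the scalars maps relations to relations.\<close>

lemma of_rat_span_relations:
  assumes "p \<in> path_chain.span (relations G)"
  shows "(Poly_Mapping.map of_rat p :: 'a list \<Rightarrow>\<^sub>0 'f::field_char_0) \<in> path_chain.span (relations G)"
  using assms
proof (induction rule: path_chain.span_induct_alt)
  case base
  have "(Poly_Mapping.map of_rat (0 :: 'a list \<Rightarrow>\<^sub>0 rat) :: 'a list \<Rightarrow>\<^sub>0 'f) = 0"
    by (rule poly_mapping_eqI) (simp add: lookup_map_fun)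
  then show ?case
    by (simp add: path_chain.span_zero)
next
  case (step c r p)
  have elem: "lookup (elem_path i :: 'a list \<Rightarrow>\<^sub>0 'f) j = of_rat (lookup (elem_path i) j)"
    for i j :: "'a list"
    by (simp add: lookup_single when_def)
  have "(Poly_Mapping.map of_rat r :: 'a list \<Rightarrow>\<^sub>0 'f) \<in> relations G"
    using step(1)
  proof (cases rule: relations_cases)
    case (1 a b)
    have "Poly_Mapping.map of_rat r = (elem_path [a, b] + elem_path [b, a] :: 'a list \<Rightarrow>\<^sub>0 'f)"
      by (rule poly_mapping_eqI) (simp only: 1 lookup_map_fun of_rat_0 lookup_add elem of_rat_add)
    then show ?thesis
      using 1 by (simp add: relations_intros)
  next
    case (2 a b c)
    have "Poly_Mapping.map of_rat r
        = (elem_path [a, b] + elem_path [b, c] - elem_path [a, c] :: 'a list \<Rightarrow>\<^sub>0 'f)"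
      by (rule poly_mapping_eqI)
        (simp only: 2 lookup_map_fun of_rat_0 lookup_add lookup_minus elem of_rat_add of_rat_diff)
    then show ?thesis
      using 2 by (simp add: relations_intros)
  next
    case (3 a b c d)
    have "Poly_Mapping.map of_rat r
        = (elem_path [a, b] + elem_path [b, c] - (elem_path [a, d] + elem_path [d, c])
            :: 'a list \<Rightarrow>\<^sub>0 'f)"
      by (rule poly_mapping_eqI)
        (simp only: 3 lookup_map_fun of_rat_0 lookup_add lookup_minus elem of_rat_add of_rat_diff)
    then show ?thesis
      using 3 by (simp only: relations_intros)
  qed
  moreover have "(Poly_Mapping.map of_rat (path_scale c r + p) :: 'a list \<Rightarrow>\<^sub>0 'f)
      = path_scale (of_rat c) (Poly_Mapping.map of_rat r) + Poly_Mapping.map of_rat p"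
    by (rule poly_mapping_eqI) (simp add: lookup_map_fun lookup_add of_rat_add of_rat_mult)
  ultimately show ?case
    using step(2) by (auto intro: path_chain.span_add path_chain.span_scale path_chain.span_base)
qed

lemma elem_boundary_2: "elem_boundary [a, b] = elem_path [b] - elem_path [a]"
  and elem_boundary_3: "elem_boundary [a, b, c] = elem_path [b, c] - elem_path [a, c] + elem_path [a, b]"
  by (simp_all add: elem_boundary_def numeral_2_eq_2 numeral_3_eq_3 lessThan_Suc
      path_chain.scale_minus_left)

lemma path_boundary_uminus: "path_boundary (- p) = - path_boundary p"
  by (metis add.right_inverse add_eq_0_iff path_boundary_add path_boundary_zero)

lemma path_boundary_diff: "path_boundary (p - q) = path_boundary p - path_boundary q"
  using path_boundary_add[of p "- q"] by (simp add: path_boundary_uminus)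

lemma path_boundary_relations:
  assumes "p \<in> path_chain.span (relations G)"
  shows "path_boundary p = 0"
  using assms
proof (induction rule: path_chain.span_induct_alt)
  case (step c r p)
  have "path_boundary r = 0"
    using step(1)
    by (rule relations_cases) (auto simp: path_boundary_add path_boundary_diff elem_boundary_2)
  then show ?case
    using step(2) by (simp add: path_boundary_add path_boundary_scale)
qed simp

context pair_graph
begin

lemma allowed_paths_1: "allowed_paths G 1 = {[a, b] | a b. (a, b) \<in> parcs G}"
proof -
  have "int (length i) = 1 + 1 \<longleftrightarrow> length i = Suc (Suc 0)" for i :: "'a list"
    by linarith
  then show ?thesis
    by (auto simp: allowed_paths_def paths_def length_Suc_conv less_Suc_eq
        dest: wellformed')
qed

lemma allowed_paths_2:
  "allowed_paths G 2 = {[a, b, c] | a b c. (a, b) \<in> parcs G \<and> (b, c) \<in> parcs G}"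
proof -
  have "int (length i) = 2 + 1 \<longleftrightarrow> length i = Suc (Suc (Suc 0))" for i :: "'a list"
    by linarith
  then show ?thesis
    by (auto simp: allowed_paths_def paths_def length_Suc_conv less_Suc_eq all_conj_distrib
        dest: wellformed')
qed

lemma finite_allowed_paths_1: "finite (allowed_paths G 1)"
  by (rule finite_subset[OF _ finite_imageI[OF pair_finite_arcs, of "\<lambda>(a, b). [a, b]"]])
    (force simp: allowed_paths_1)

lemma finite_relations: "finite (relations G :: ('a list \<Rightarrow>\<^sub>0 'f::field) set)"
proof -
  let ?V = "pverts G"
  let ?e = "\<lambda>a b. elem_path [a, b] :: 'a list \<Rightarrow>\<^sub>0 'f"
  have "relations G \<subseteq> (\<lambda>(a, b). ?e a b + ?e b a) ` (?V \<times> ?V)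
      \<union> (\<lambda>(a, b, c). ?e a b + ?e b c - ?e a c) ` (?V \<times> ?V \<times> ?V)
      \<union> (\<lambda>(a, b, c, d). ?e a b + ?e b c - (?e a d + ?e d c)) ` (?V \<times> ?V \<times> ?V \<times> ?V)"
    (is "_ \<subseteq> ?R")
  proof
    have V: "a \<in> ?V \<and> b \<in> ?V" if "(a, b) \<in> parcs G" for a b
      using that by (auto dest: arc_fst_in_verts arc_snd_in_verts)
    fix r :: "'a list \<Rightarrow>\<^sub>0 'f"
    assume "r \<in> relations G"
    then show "r \<in> ?R"
    proof (cases rule: relations_cases)
      case (1 a b)
      then show ?thesis
        using V by (intro UnI1 image_eqI[of _ _ "(a, b)"]) auto
    next
      case (2 a b c)
      then show ?thesis
        using V by (intro UnI1 UnI2 image_eqI[of _ _ "(a, b, c)"]) auto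
    next
      case (3 a b c d)
      then show ?thesis
        using V by (intro UnI2 image_eqI[of _ _ "(a, b, c, d)"]) auto
    qed
  qed
  then show ?thesis
    by (rule finite_subset) (simp add: pair_finite_verts)
qed

lemma span_relations_allowed:
  "path_chain.span (relations G) \<subseteq> path_chain.span (elem_path ` allowed_paths G 1)"
proof (intro path_chain.span_minimal[OF _ path_chain.subspace_span] subsetI)
  have arc: "elem_path [a, b] \<in> path_chain.span (elem_path ` allowed_paths G 1)"
    if "(a, b) \<in> parcs G" for a b
    using that by (intro path_chain.span_base) (auto simp: allowed_paths_1)
  fix r :: "'a list \<Rightarrow>\<^sub>0 'b"
  assume "r \<in> relations G"
  then show "r \<in> path_chain.span (elem_path ` allowed_paths G 1)"
    by (rule relations_cases)
      (auto intro!: path_chain.span_add path_chain.span_diff arc arcs_symmetric)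
qed

lemma lookup_path_boundary_1:
  assumes "p \<in> path_chain.span (elem_path ` allowed_paths G 1)"
  shows "lookup (path_boundary p) [v]
    = (\<Sum>u | (v, u) \<in> parcs G. lookup p [u, v]) - (\<Sum>u | (v, u) \<in> parcs G. lookup p [v, u])"
  using assms
proof (induction rule: path_chain.span_induct_alt)
  case (step c x y)
  then obtain a b where x: "x = elem_path [a, b]" and ab: "(a, b) \<in> parcs G"
    by (auto simp: allowed_paths_1)
  have "(\<Sum>u | (v, u) \<in> parcs G. lookup x [u, v]) = (if b = v then 1 else 0)"
    "(\<Sum>u | (v, u) \<in> parcs G. lookup x [v, u]) = (if a = v then 1 else 0)"
    using ab arcs_symmetric[OF ab] by (auto simp: x lookup_single when_def)
  then show ?case
    using step(2)
    by (simp add: path_boundary_add path_boundary_scale lookup_add sum.distrib x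
        elem_boundary_2 lookup_minus algebra_simps flip: sum_distrib_left)
       (simp add: lookup_single when_def)
qed simp

text \<open>
  The Hodge decomposition in degree one. The part of \<open>z\<close> orthogonal to the relations is a
  harmonic form: orthogonality to each kind of relation is one of the closedness conditions, and
  for an antisymmetric chain the balance of inflow and outflow at a vertex says that the outflow
  is \<open>0\<close>.
\<close>

lemma rational_cycle_in_span_relations:
  fixes z :: "'a list \<Rightarrow>\<^sub>0 rat"
  assumes K: "K > 0" "curvature_dimension G K \<infinity>"
    and z: "z \<in> path_chain.span (elem_path ` allowed_paths G 1)"
    and cycle: "\<And>v. (\<Sum>u | (v, u) \<in> parcs G. lookup z [u, v]) = (\<Sum>u | (v, u) \<in> parcs G. lookup z [v, u])"
  shows "z \<in> path_chain.span (relations G)"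
proof -
  let ?A = "allowed_paths G 1"
  obtain p where p: "p \<in> path_chain.span (relations G)"
    and orth: "\<And>r. r \<in> relations G \<Longrightarrow> dot ?A (z - p) r = 0"
    using orthogonal_decomposition[OF finite_relations finite_allowed_paths_1] by blast
  define h where "h = z - p"
  have p_allowed: "p \<in> path_chain.span (elem_path ` ?A)"
    using p span_relations_allowed by blast
  then have h: "h \<in> path_chain.span (elem_path ` ?A)"
    using z unfolding h_def by (intro path_chain.span_diff)
  have arc: "dot ?A h (elem_path [a, b]) = lookup h [a, b]" if "(a, b) \<in> parcs G" for a b
    using that by (intro dot_elem_path finite_allowed_paths_1) (auto simp: allowed_paths_1)
  have anti: "lookup h [b, a] = - lookup h [a, b]" if ab: "(a, b) \<in> parcs G" for a b
  proof -
    have "dot ?A h (elem_path [a, b] + elem_path [b, a]) = 0"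
      using ab unfolding h_def by (intro orth relations_intros)
    then show ?thesis
      using ab arcs_symmetric[OF ab] by (simp add: dot_add_right arc)
  qed
  have triangle: "lookup h [a, c] = lookup h [a, b] + lookup h [b, c]"
    if abc: "(a, b) \<in> parcs G" "(b, c) \<in> parcs G" "(a, c) \<in> parcs G" for a b c
  proof -
    have "dot ?A h (elem_path [a, b] + elem_path [b, c] - elem_path [a, c]) = 0"
      using abc unfolding h_def by (intro orth relations_intros)
    then show ?thesis
      using abc by (simp add: dot_add_right dot_diff_right arc)
  qed
  have square: "lookup h [a, b] + lookup h [b, c] = lookup h [a, d] + lookup h [d, c]"
    if abcd: "(a, b) \<in> parcs G" "(b, c) \<in> parcs G" "(a, d) \<in> parcs G" "(d, c) \<in> parcs G"
    for a b c d
  proof -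
    have "dot ?A h (elem_path [a, b] + elem_path [b, c] - (elem_path [a, d] + elem_path [d, c])) = 0"
      using abcd unfolding h_def by (intro orth relations_intros)
    then show ?thesis
      using abcd by (simp add: dot_add_right dot_diff_right arc)
  qed
  have coclosed: "(\<Sum>u | (v, u) \<in> parcs G. lookup h [v, u]) = 0" for v
  proof -
    have "(\<Sum>u | (v, u) \<in> parcs G. lookup p [u, v]) = (\<Sum>u | (v, u) \<in> parcs G. lookup p [v, u])"
      using lookup_path_boundary_1[OF p_allowed, of v] path_boundary_relations[OF p] by simp
    then have "(\<Sum>u | (v, u) \<in> parcs G. lookup h [u, v]) = (\<Sum>u | (v, u) \<in> parcs G. lookup h [v, u])"
      using cycle[of v] by (simp add: h_def lookup_minus sum_subtractf)
    moreover have "(\<Sum>u | (v, u) \<in> parcs G. lookup h [u, v])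
        = - (\<Sum>u | (v, u) \<in> parcs G. lookup h [v, u])"
      using anti by (simp add: sum_negf[symmetric])
    ultimately show ?thesis
      by simp
  qed
  have "(of_rat (lookup h [a, b]) :: real) = 0" if ab: "(a, b) \<in> parcs G" for a b
    using K _ _ _ _ ab
  proof (rule harmonic_form_eq_0[where \<phi> = "\<lambda>a b. of_rat (lookup h [a, b])"])
    show "of_rat (lookup h [b, a]) = - (of_rat (lookup h [a, b]) :: real)"
      if "(a, b) \<in> parcs G" for a b
      using anti[OF that] by (simp add: of_rat_minus)
    show "(of_rat (lookup h [a, c]) :: real) = of_rat (lookup h [a, b]) + of_rat (lookup h [b, c])"
      if "(a, b) \<in> parcs G" "(b, c) \<in> parcs G" "(a, c) \<in> parcs G" for a b c
      using triangle[OF that] by (simp add: of_rat_add)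
    show "(of_rat (lookup h [a, b]) + of_rat (lookup h [b, c]) :: real)
        = of_rat (lookup h [a, d]) + of_rat (lookup h [d, c])"
      if "(a, b) \<in> parcs G" "(b, c) \<in> parcs G" "(a, d) \<in> parcs G" "(d, c) \<in> parcs G" for a b c d
      using square[OF that] by (simp flip: of_rat_add)
    show "(\<Sum>b | (a, b) \<in> parcs G. of_rat (lookup h [a, b]) :: real) = 0" for a
      using coclosed[of a] by (simp flip: of_rat_sum)
  qed
  then have "lookup h i = 0" if "i \<in> ?A" for i
    using that by (auto simp: allowed_paths_1)
  moreover have "keys h \<subseteq> ?A"
    using h by (simp add: keys_subset_iff_span)
  ultimately have "h = 0"
    by (intro poly_mapping_eqI) (metis in_keys_iff lookup_zero subsetD)
  then show ?thesis
    using p by (simp add: h_def)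
qed

text \<open>
  Orthogonal projection is not available over an arbitrary field of characteristic \<open>0\<close>, where a sum
  of squares may vanish. Instead the field is regarded as a vector space over the rationals. Being
  a cycle is a system of equations with coefficients \<open>1\<close> and \<open>-1\<close>, so it is inherited by each
  rational coordinate \<open>c \<beta>\<close> of \<open>z\<close>.
\<close>

lemma cycle_in_span_relations:
  fixes z :: "'a list \<Rightarrow>\<^sub>0 'f::field_char_0"
  assumes K: "K > 0" "curvature_dimension G K \<infinity>"
    and z: "z \<in> path_chain.span (elem_path ` allowed_paths G 1)"
    and cycle: "path_boundary z = 0"
  shows "z \<in> path_chain.span (relations G)"
proof -
  interpret Q: vector_space "\<lambda>q (x :: 'f). of_rat q * x"
    by unfold_locales (simp_all add: algebra_simps of_rat_add of_rat_mult)
  define B where "B = Q.extend_basis {}"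
  have B: "Q.independent B" "Q.span B = UNIV"
    unfolding B_def using Q.independent_empty
    by (rule Q.independent_extend_basis Q.span_extend_basis)+
  define coord where "coord \<beta> x = Q.representation B x \<beta>" for \<beta> x
  have coord_add: "coord \<beta> (x + y) = coord \<beta> x + coord \<beta> y"
    and coord_0: "coord \<beta> 0 = 0" for \<beta> x y
    unfolding coord_def using B by (simp_all add: Q.representation_add Q.representation_zero)
  have coord_sum: "coord \<beta> (\<Sum>i\<in>I. f i) = (\<Sum>i\<in>I. coord \<beta> (f i))" for \<beta> f and I :: "'a set"
    by (induction I rule: infinite_finite_induct) (simp_all add: coord_0 coord_add)
  have coord_finite: "finite {\<beta>. coord \<beta> x \<noteq> 0}" for x
    by (simp add: coord_def Q.finite_representation)
  have coord_expand: "(\<Sum>\<beta> | coord \<beta> x \<noteq> 0. of_rat (coord \<beta> x) * \<beta>) = x" for x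
    unfolding coord_def using B by (intro Q.sum_nonzero_representation_eq) auto
  define c where "c \<beta> = Poly_Mapping.map (coord \<beta>) z" for \<beta>
  have lookup_c: "lookup (c \<beta>) i = coord \<beta> (lookup z i)" for \<beta> i
    by (simp add: c_def lookup_map_fun coord_0)
  have c_relations: "c \<beta> \<in> path_chain.span (relations G)" for \<beta>
  proof (rule rational_cycle_in_span_relations[OF K])
    have "keys (c \<beta>) \<subseteq> keys z"
      by (auto simp: in_keys_iff lookup_c coord_0)
    then show "c \<beta> \<in> path_chain.span (elem_path ` allowed_paths G 1)"
      using z by (auto simp flip: keys_subset_iff_span)
    show "(\<Sum>u | (v, u) \<in> parcs G. lookup (c \<beta>) [u, v])
        = (\<Sum>u | (v, u) \<in> parcs G. lookup (c \<beta>) [v, u])" for v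
      using lookup_path_boundary_1[OF z, of v] cycle
      by (simp add: lookup_c flip: coord_sum)
  qed
  define S where "S = (\<Union>i\<in>keys z. {\<beta>. coord \<beta> (lookup z i) \<noteq> 0})"
  have "finite S"
    by (simp add: S_def coord_finite)
  have "z = (\<Sum>\<beta>\<in>S. path_scale \<beta> (Poly_Mapping.map of_rat (c \<beta>)))"
  proof (rule poly_mapping_eqI)
    fix i
    have "{\<beta>. coord \<beta> (lookup z i) \<noteq> 0} \<subseteq> S"
      by (cases "i \<in> keys z") (auto simp: S_def in_keys_iff coord_0)
    then have "(\<Sum>\<beta>\<in>S. \<beta> * of_rat (coord \<beta> (lookup z i)))
        = (\<Sum>\<beta> | coord \<beta> (lookup z i) \<noteq> 0. of_rat (coord \<beta> (lookup z i)) * \<beta>)"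
      using \<open>finite S\<close>
      by (intro sum.mono_neutral_cong_right) (auto simp: mult.commute)
    then show "lookup z i = lookup (\<Sum>\<beta>\<in>S. path_scale \<beta> (Poly_Mapping.map of_rat (c \<beta>))) i"
      by (simp add: lookup_sum lookup_map_fun lookup_c coord_expand)
  qed
  also have "\<dots> \<in> path_chain.span (relations G)"
    by (intro path_chain.span_sum path_chain.span_scale of_rat_span_relations c_relations)
  finally show ?thesis .
qed

section \<open>Short cycles are boundaries\<close>

lemma span_relations_boundary:
  assumes "p \<in> path_chain.span (relations G)"
  shows "\<exists>\<omega>\<in>path_chain.span (elem_path ` allowed_paths G 2).
    path_boundary \<omega> - p \<in> irregular_space G 1"
  using assms
proof (induction rule: path_chain.span_induct_alt)
  case base
  show ?case
    by (intro bexI[of _ 0]) (simp_all add: irregular_space_def path_chain.span_zero)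
next
  case (step c r p)
  have path: "elem_path [a, b, c] \<in> path_chain.span (elem_path ` allowed_paths G 2)"
    if "(a, b) \<in> parcs G" "(b, c) \<in> parcs G" for a b c
    using that by (intro path_chain.span_base) (auto simp: allowed_paths_2)
  have "\<exists>\<omega>\<in>path_chain.span (elem_path ` allowed_paths G 2).
      path_boundary \<omega> - r \<in> irregular_space G 1"
    using step(1)
  proof (rule relations_cases)
    fix a b
    assume r: "r = elem_path [a, b] + elem_path [b, a]" and ab: "(a, b) \<in> parcs G"
    \<comment> \<open>Only here do \<open>r\<close> and the boundary differ, by the irregular middle face of \<open>e\<^bsub>aba\<^esub>\<close>.\<close>
    have "[a, a] \<in> irregular_paths G 1"
      using arc_fst_in_verts[OF ab] by (auto simp: irregular_paths_def paths_def)
    then have "elem_path [a, a] \<in> irregular_space G 1"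
      unfolding irregular_space_def by (intro path_chain.span_base) auto
    then have "path_boundary (elem_path [a, b, a]) - r \<in> irregular_space G 1"
      unfolding r irregular_space_def
      using path_chain.span_neg[of "elem_path [a, a]"] by (simp add: elem_boundary_3)
    then show ?thesis
      using path[OF ab arcs_symmetric[OF ab]] by blast
  next
    fix a b c
    assume r: "r = elem_path [a, b] + elem_path [b, c] - elem_path [a, c]"
      and arcs: "(a, b) \<in> parcs G" "(b, c) \<in> parcs G"
    have "path_boundary (elem_path [a, b, c]) - r = 0"
      by (simp add: r elem_boundary_3)
    then show ?thesis
      using path[OF arcs] path_chain.span_zero unfolding irregular_space_def by metis
  next
    fix a b c d
    assume r: "r = elem_path [a, b] + elem_path [b, c] - (elem_path [a, d] + elem_path [d, c])"
      and arcs: "(a, b) \<in> parcs G" "(b, c) \<in> parcs G" "(a, d) \<in> parcs G" "(d, c) \<in> parcs G"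
    have "path_boundary (elem_path [a, b, c] - elem_path [a, d, c]) - r = 0"
      by (simp add: r path_boundary_diff elem_boundary_3)
    then show ?thesis
      using path_chain.span_diff[OF path[OF arcs(1,2)] path[OF arcs(3,4)]] path_chain.span_zero
      unfolding irregular_space_def by metis
  qed
  then obtain \<omega> where \<omega>: "\<omega> \<in> path_chain.span (elem_path ` allowed_paths G 2)"
    "path_boundary \<omega> - r \<in> irregular_space G 1"
    by blast
  obtain \<eta> where \<eta>: "\<eta> \<in> path_chain.span (elem_path ` allowed_paths G 2)"
    "path_boundary \<eta> - p \<in> irregular_space G 1"
    using step(2) by blast
  have "path_boundary (path_scale c \<omega> + \<eta>) - (path_scale c r + p)
      = path_scale c (path_boundary \<omega> - r) + (path_boundary \<eta> - p)"
    by (simp add: path_boundary_add path_boundary_scale path_chain.scale_right_diff_distrib)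
  also have "\<dots> \<in> irregular_space G 1"
    using \<omega> \<eta> unfolding irregular_space_def by (intro path_chain.span_add path_chain.span_scale)
  finally show ?case
    using \<omega>(1) \<eta>(1)
    by (intro bexI[of _ "path_scale c \<omega> + \<eta>"]) (auto intro: path_chain.span_add path_chain.span_scale)
qed

lemma path_boundary_boundary_2:
  assumes "p \<in> path_chain.span (elem_path ` allowed_paths G 2)"
  shows "path_boundary (path_boundary p) = 0"
  using assms
  by (induction rule: path_chain.span_induct_alt)
    (auto simp: allowed_paths_2 path_boundary_add path_boundary_diff path_boundary_scale
      elem_boundary_2 elem_boundary_3)

section \<open>The homology group\<close>

lemma regular_class_0: "regular_class G 0 p = {p}"
proof -
  have "irregular_paths G 0 = {}"
    by (auto simp: irregular_paths_def paths_def)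
  then show ?thesis
    by (simp add: regular_class_eq irregular_space_def)
qed

lemma regular_boundary_1: "regular_boundary G 1 (regular_class G 1 p) = {path_boundary p}"
  by (simp add: regular_boundary_class regular_class_0)

lemma regular_boundary_2:
  "regular_boundary G 2 (regular_class G 2 p) = regular_class G 1 (path_boundary p)"
  by (simp add: regular_boundary_class)

definition cycles_1 :: "('a list \<Rightarrow>\<^sub>0 'f::field) set" where
  "cycles_1 = {p \<in> path_chain.span (elem_path ` allowed_paths G 1). path_boundary p = 0}"

lemma kernel_regular_boundary_1:
  "kernel (Omega_group G 1) (Omega_group G 0) (regular_boundary G 1)
    = regular_class G 1 ` (cycles_1 :: ('a list \<Rightarrow>\<^sub>0 'f::field) set)"
proof -
  let ?zero = "{0} :: ('a list \<Rightarrow>\<^sub>0 'f) set"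
  have "irregular_space G 0 = ?zero"
    using regular_class_0[of "0 :: 'a list \<Rightarrow>\<^sub>0 'f"] by (simp add: regular_class_eq)
  then have one: "one (Omega_group G 0) = ?zero"
    by (simp add: Omega_group_def regular_group_def)
  have carrier: "carrier (Omega_group G 1) = (Omega G 1 :: ('a list \<Rightarrow>\<^sub>0 'f) set set)"
    by (simp add: Omega_group_def)
  have "?zero \<in> allowed_space G 0"
    unfolding allowed_space_def using path_chain.span_zero
    by (force simp: regular_class_0)
  then show ?thesis
    by (auto simp: kernel_def one carrier Omega_def allowed_space_def[of G 1] regular_boundary_1
        cycles_1_def)
qed

lemma image_regular_boundary_2_subset:
  "regular_boundary G 2 ` Omega G 2 \<subseteq> regular_class G 1 ` cycles_1"
proof (clarsimp simp: Omega_def allowed_space_def regular_boundary_2)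
  fix \<omega> p :: "'a list \<Rightarrow>\<^sub>0 'b"
  assume \<omega>: "\<omega> \<in> path_chain.span (elem_path ` allowed_paths G 2)"
    and p: "regular_class G 1 (path_boundary \<omega>) = regular_class G 1 p"
      "p \<in> path_chain.span (elem_path ` allowed_paths G 1)"
  have "{path_boundary p} = {path_boundary (path_boundary \<omega>)}"
    using p(1) by (metis regular_boundary_1)
  then have "p \<in> cycles_1"
    using p(2) path_boundary_boundary_2[OF \<omega>] by (simp add: cycles_1_def)
  then show "regular_class G 1 p \<in> regular_class G 1 ` cycles_1"
    by blast
qed

text \<open>
  The \<open>2\<close>-chain provided by \<open>span_relations_boundary\<close> lies in \<open>\<Omega>\<^sub>2\<close> because modulo irregular paths
  its boundary is a relation, and relations consist of allowed paths.
\<close>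

lemma regular_class_relations_boundary:
  assumes "p \<in> path_chain.span (relations G)"
  shows "regular_class G 1 p \<in> regular_boundary G 2 ` Omega G 2"
proof -
  obtain \<omega> where \<omega>: "\<omega> \<in> path_chain.span (elem_path ` allowed_paths G 2)"
    "path_boundary \<omega> - p \<in> irregular_space G 1"
    using span_relations_boundary[OF assms] by blast
  have bd: "regular_boundary G 2 (regular_class G 2 \<omega>) = regular_class G 1 p"
    using regular_class_absorb[OF \<omega>(2), of p] by (simp add: regular_boundary_2)
  have "regular_class G 2 \<omega> \<in> Omega G 2"
    using \<omega>(1) assms span_relations_allowed bd by (auto simp: Omega_def allowed_space_def)
  with bd show ?thesis
    by force
qed

text \<open>The cycle classes are the image of a subgroup under the projection to regular chains.\<close>

lemma group_cycle_classes:
  "group ((regular_group G 1)\<lparr>carrier := regular_class G 1 ` (cycles_1 :: ('a list \<Rightarrow>\<^sub>0 'f::field) set)\<rparr>)"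
proof -
  let ?P = "path_group G 1 :: ('a list \<Rightarrow>\<^sub>0 'f) monoid"
  interpret P: comm_group ?P
    by (rule comm_groupI)
      (auto simp: path_group_def path_space_def path_chain.span_zero path_chain.span_add
        algebra_simps intro!: bexI[of _ "- _"] path_chain.span_neg)
  have inv: "inv\<^bsub>?P\<^esub> p = - p" if "p \<in> path_space G 1" for p
    using that
    by (intro P.inv_equality) (auto simp: path_group_def path_space_def path_chain.span_neg)
  have "subgroup (irregular_space G 1) ?P"
  proof
    show "irregular_space G 1 \<subseteq> carrier ?P"
      unfolding irregular_space_def path_group_def path_space_def
      by (simp, intro path_chain.span_mono) (auto simp: irregular_paths_def)
    then show "inv\<^bsub>?P\<^esub> p \<in> irregular_space G 1" if "p \<in> irregular_space G 1" for p
      using that inv[of p] by (auto simp: path_group_def irregular_space_def path_chain.span_neg)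
  qed (auto simp: path_group_def irregular_space_def path_chain.span_zero path_chain.span_add)
  then interpret N: normal "irregular_space G 1" ?P
    by (simp add: P.normal_iff_subgroup)
  interpret hom: group_hom ?P "regular_group G 1" "regular_class G 1"
    unfolding group_hom_def group_hom_axioms_def regular_group_def regular_class_def[abs_def]
    using P.is_group N.factorgroup_is_group N.r_coset_hom_Mod by blast
  have "subgroup cycles_1 ?P"
  proof
    have "path_chain.span (elem_path ` allowed_paths G 1) \<subseteq> (path_space G 1 :: ('a list \<Rightarrow>\<^sub>0 'f) set)"
      unfolding path_space_def by (intro path_chain.span_mono) (auto simp: allowed_paths_def)
    then show sub: "cycles_1 \<subseteq> carrier ?P"
      by (auto simp: cycles_1_def path_group_def)
    show "inv\<^bsub>?P\<^esub> p \<in> cycles_1" if "p \<in> cycles_1" for p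
      using that sub inv[of p]
      by (auto simp: path_group_def cycles_1_def path_chain.span_neg path_boundary_uminus)
  qed (auto simp: path_group_def cycles_1_def path_chain.span_zero path_chain.span_add
      path_boundary_add)
  then show ?thesis
    by (intro group.subgroup_imp_group hom.H.is_group hom.subgroup_img_is_subgroup)
qed

end

lemma (in group) trivial_group_Mod_carrier: "trivial_group (G Mod carrier G)"
proof -
  interpret N: normal "carrier G" G
    by (rule normal_self)
  have "carrier (G Mod carrier G) = {carrier G}"
    using N.rcos_const[OF is_group] one_closed by (auto simp: carrier_FactGroup image_iff)
  then show ?thesis
    using N.factorgroup_is_group by (simp add: trivial_group_def)
qed

theorem theorem1p1:
  fixes G :: "'a pair_pre_digraph" and K :: real
  assumes "pair_graph G"
    and "K > 0"
    and "curvature_dimension G K \<infinity>"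
  shows "trivial_group (path_homology TYPE('f::field_char_0) G 1)"
proof -
  interpret pair_graph G
    by fact
  let ?Z = "regular_class G 1 ` (cycles_1 :: ('a list \<Rightarrow>\<^sub>0 'f) set)"
  let ?H = "(regular_group G 1)\<lparr>carrier := ?Z\<rparr>"
  have "regular_boundary G 2 ` Omega G 2 = ?Z"
  proof
    show "?Z \<subseteq> regular_boundary G 2 ` Omega G 2"
      using cycle_in_span_relations[OF assms(2,3)] regular_class_relations_boundary
      by (auto simp: cycles_1_def)
  qed (rule image_regular_boundary_2_subset)
  then have "path_homology TYPE('f) G 1 = ?H Mod carrier ?H"
    by (simp add: path_homology_def kernel_regular_boundary_1) (simp add: Omega_group_def)
  then show ?thesis
    using group.trivial_group_Mod_carrier[OF group_cycle_classes] by metis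
qed

end
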